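(* For integers $h,k\ge 0$ with $h+k\geq 1$ let $f_{h,k}=1^h0^k$ (the binary word consisting of $h$ ones followed by $k$ zeros). Then $f_{h,k}$ is tilde-isometric for all such $h,k$ except for $h=k=2$; that is, $f_{h,k}$ is tilde-isometric whenever $(h,k)\neq(2,2)$, and $f_{2,2}=1100$ is tilde-non-isometric.
   Context: Words are over $\Sigma=\{0,1\}$; $\overline{0}=1$, $\overline{1}=0$. For a word $w=a_1\cdots a_m$: the replacement $R_i$ at position $i$ ($1\le i\le m$) changes $a_i$ into $\overline{a_i}$; the swap $S_i$ at position $i$ ($1\le i\le m-1$) is applicable only when $a_i\neq a_{i+1}$ and exchanges $a_i$ and $a_{i+1}$. $R_i$ modifies position $i$; $S_i$ modifies positions $i$ and $i+1$. For words $u,v$ of equal length, the tilde-distance $\mathrm{dist}_\sim(u,v)$ is the minimum number of replacements and swaps needed to transform $u$ into $v$. A tilde-transformation of length $h$ from $u$ to $v$ is a sequence of words $(w_0,\dots,w_h)$ with $w_0=u$, $w_h=v$ and $\mathrm{dist}_\sim(w_k,w_{k+1})=1$ for $k=0,\dots,h-1$; so each $w_{k+1}$ is obtained from $w_k$ by one replacement or swap. It is minimal if $h=\mathrm{dist}_\sim(u,v)$ and the character in each position is modified at most once by the sequence of operations. A word is $f$-free if it does not contain $f$ as a factor (contiguous subword); a tilde-transformation is $f$-free if all its words $w_0,\dots,w_h$ are $f$-free. A word $f$ of length $n\ge 1$ is tilde-isometric if for every pair of $f$-free words $u,v$ of equal length $m\ge n$ there exists a minimal tilde-transformation from $u$ to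 $v$ that is $f$-free. It is tilde-non-isometric if it is not tilde-isometric. *)

theory Defs
  imports Main "HOL-Library.Sublist"
begin

text \<open>Binary words are lists over \<open>bool\<close>, with \<open>True\<close> for the letter 1 and \<open>False\<close> for 0.
  Positions are counted from 0, so \<open>Repl i\<close> and \<open>Swap i\<close> are the operations usually
  written \<open>R\<close> and \<open>S\<close> with index \<open>i + 1\<close>.\<close>

type_synonym word = "bool list"

datatype edit = Repl nat | Swap nat

fun applicable :: "edit \<Rightarrow> word \<Rightarrow> bool" where
  "applicable (Repl i) w \<longleftrightarrow> i < length w"
| "applicable (Swap i) w \<longleftrightarrow> Suc i < length w \<and> w ! i \<noteq> w ! Suc i"

fun apply_edit :: "edit \<Rightarrow> word \<Rightarrow> word" where
  "apply_edit (Repl i) w = w[i := \<not> w ! i]"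
| "apply_edit (Swap i) w = w[i := w ! Suc i, Suc i := w ! i]"

fun modified :: "edit \<Rightarrow> nat set" where
  "modified (Repl i) = {i}"
| "modified (Swap i) = {i, Suc i}"

definition edit_step :: "word \<Rightarrow> word \<Rightarrow> bool" where
  "edit_step u v \<longleftrightarrow> (\<exists>e. applicable e u \<and> v = apply_edit e u)"

text \<open>Only meaningful for words of equal length: otherwise no number of steps leads
  from \<open>u\<close> to \<open>v\<close>, and the value is unspecified.\<close>

definition tilde_dist :: "word \<Rightarrow> word \<Rightarrow> nat" where
  "tilde_dist u v = (LEAST h. (edit_step ^^ h) u v)"

text \<open>The list \<open>ws\<close> consists of the words \<open>w\<^sub>0, \<dots>, w\<^sub>h\<close>, so the transformation has
  length \<open>h = length ws - 1\<close>. Equality of lengths is required because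
  \<^const>\<open>tilde_dist\<close> is unspecified without it.\<close>

definition tilde_transformation :: "word list \<Rightarrow> word \<Rightarrow> word \<Rightarrow> bool" where
  "tilde_transformation ws u v \<longleftrightarrow>
     ws \<noteq> [] \<and> hd ws = u \<and> last ws = v \<and>
     (\<forall>k. Suc k < length ws \<longrightarrow>
        length (ws ! k) = length (ws ! Suc k) \<and> tilde_dist (ws ! k) (ws ! Suc k) = 1)"

definition minimal_tilde_transformation :: "word list \<Rightarrow> word \<Rightarrow> word \<Rightarrow> bool" where
  "minimal_tilde_transformation ws u v \<longleftrightarrow>
     tilde_transformation ws u v \<and>
     length ws - 1 = tilde_dist u v \<and>
     (\<exists>es. length es = length ws - 1 \<and>
        (\<forall>k < length es. applicable (es ! k) (ws ! k) \<and>
                         ws ! Suc k = apply_edit (es ! k) (ws ! k)) \<and>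
        (\<forall>i. card {k. k < length es \<and> i \<in> modified (es ! k)} \<le> 1))"

definition free_of :: "word \<Rightarrow> word \<Rightarrow> bool" where
  "free_of f w \<longleftrightarrow> \<not> sublist f w"

definition tilde_isometric :: "word \<Rightarrow> bool" where
  "tilde_isometric f \<longleftrightarrow>
     length f \<ge> 1 \<and>
     (\<forall>u v. length u = length v \<and> length u \<ge> length f \<and> free_of f u \<and> free_of f v \<longrightarrow>
        (\<exists>ws. minimal_tilde_transformation ws u v \<and> (\<forall>w \<in> set ws. free_of f w)))"

definition tilde_non_isometric :: "word \<Rightarrow> bool" where
  "tilde_non_isometric f \<longleftrightarrow> length f \<ge> 1 \<and> \<not> tilde_isometric f"

definition ones_zeros :: "nat \<Rightarrow> nat \<Rightarrow> word" where
  "ones_zeros h k = replicate h True @ replicate k False"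

end

theory Submission
  imports Defs
begin

text \<open>Reading two words from left to right, and pairing a mismatch with the next position whenever a
  swap corrects both, yields a number \<open>cost\<close> that changes by at most one under an edit, hence
  equals the tilde-distance. It therefore suffices to find, for distinct \<open>f\<close>-free words \<open>u\<close> and
  \<open>v\<close>, one edit of \<open>u\<close> or of \<open>v\<close> that only touches mismatched positions, lowers the cost and
  creates no occurrence of \<open>f\<close>: edits of \<open>u\<close> are prepended to the transformation, and edits of
  \<open>v\<close>, being involutions, are appended. Such an edit exists near the first mismatch unless
  \<open>h = k = 2\<close>.\<close>

section \<open>The greedy cost as a lower bound for the tilde-distance\<close>

text \<open>Over two letters, \<open>a \<noteq> b\<close>, \<open>a' \<noteq> b'\<close> and
  \<open>a \<noteq> a'\<close> force \<open>a' = b\<close> and \<open>a = b'\<close>, so the second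
  test asks whether one swap corrects both positions.\<close>

fun cost :: "word \<Rightarrow> word \<Rightarrow> nat" where
  "cost (a # a' # u) (b # b' # v) =
     (if a = b then cost (a' # u) (b' # v)
      else if a' \<noteq> b' \<and> a \<noteq> a' then Suc (cost u v)
      else Suc (cost (a' # u) (b' # v)))"
| "cost [a] [b] = (if a = b then 0 else 1)"
| "cost _ _ = 0"

lemma cost_same [simp]: "cost w w = 0"
  by (induction w rule: induct_list012) auto

lemma cost_Cons_same [simp]:
  assumes "length u = length v"
  shows "cost (a # u) (a # v) = cost u v"
  using assms by (cases u; cases v) auto

lemma cost_commute: "cost u v = cost v u"
proof (induction u v rule: cost.induct)
  case (1 a a' u b b' v)
  consider "a = b" | "a \<noteq> b" "a' \<noteq> b' \<and> a \<noteq> a'" | "a \<noteq> b" "\<not> (a' \<noteq> b' \<and> a \<noteq> a')" by blast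
  then show ?case
  proof cases
    case 1
    then show ?thesis using "1.IH"(1) by simp
  next
    case 2
    then show ?thesis using "1.IH"(2) by auto
  next
    case 3
    then have "cost (a # a' # u) (b # b' # v) = Suc (cost (a' # u) (b' # v))"
      "cost (b # b' # v) (a # a' # u) = Suc (cost (b' # v) (a' # u))" by auto
    then show ?thesis using "1.IH"(3)[OF 3] by (simp only:)
  qed
qed auto

text \<open>If the new letter forms a swap with the next one, the pairing along an alternating run
  of mismatches shifts by one place; the induction follows this shift two letters at a time.\<close>

lemma cost_Cons_bounds:
  assumes "length u = length v"
  shows "cost u v \<le> cost (a # u) (b # v) \<and> cost (a # u) (b # v) \<le> Suc (cost u v)"
  using assms
proof (induction u v arbitrary: a b rule: cost.induct)
  case (1 a1 a2 u b1 b2 v)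
  show ?case
  proof (cases "a = b")
    case False
    then show ?thesis using 1 by (auto split: if_splits)
  qed auto
qed auto

lemma cost_Cons_ge: "length u = length v \<Longrightarrow> cost u v \<le> cost (a # u) (b # v)"
  and cost_Cons_le: "length u = length v \<Longrightarrow> cost (a # u) (b # v) \<le> Suc (cost u v)"
  using cost_Cons_bounds by blast+

text \<open>An edit beyond the letters read first is passed on to the induction hypothesis; an edit
  of the first letters is compared through the bounds for prefixing a letter. Iterated, this makes
  \<open>cost\<close> a lower bound for the number of edits.\<close>

lemma cost_apply_edit:
  assumes "length u = length v" "applicable e u"
  shows "cost u v \<le> Suc (cost (apply_edit e u) v)"
  using assms
proof (induction u v arbitrary: e rule: cost.induct)
  case (1 a a' u b b' v)
  have len: "length u = length v" using 1 by simp
  note bnds = cost_Cons_ge[OF len, of a' b'] cost_Cons_le[OF len, of a' b']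
     cost_Cons_ge[OF len, of "\<not>a'" b'] cost_Cons_le[OF len, of "\<not>a'" b']
  consider (R0) "e = Repl 0" | (R1) "e = Repl 1" | (R) i where "e = Repl (Suc (Suc i))"
    | (S0) "e = Swap 0" | (S1) "e = Swap 1" | (S) i where "e = Swap (Suc (Suc i))"
    by (metis One_nat_def edit.exhaust not0_implies_Suc)
  then show ?case
  proof cases
    case R0 then show ?thesis using bnds by auto
  next
    case R1
    then have *: "a = b \<Longrightarrow> cost (a' # u) (b' # v) \<le> Suc (cost ((\<not>a') # u) (b' # v))"
      using bnds by auto
    show ?thesis using R1 bnds * by auto
  next
    case (R i)
    have *: "applicable (Repl (Suc i)) (a' # u)" "applicable (Repl i) u" using 1 R by auto
    consider "a = b" | "a \<noteq> b" "a' \<noteq> b' \<and> a \<noteq> a'" | "a \<noteq> b" "\<not> (a' \<noteq> b' \<and> a \<noteq> a')" by blast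
    then show ?thesis
    proof cases
      case 1
      then show ?thesis using "1.IH"(1)[OF 1 _ *(1)] R len by simp
    next
      case 2
      then show ?thesis using "1.IH"(2)[OF 2 _ *(2)] R len by simp
    next
      case 3
      then show ?thesis using "1.IH"(3)[OF 3 _ *(1)] R len by auto
    qed
  next
    case S0
    then have "a' = (\<not> a)" using "1.prems" by auto
    with S0 show ?thesis using bnds len by (cases a; cases b; cases b') simp_all
  next
    case S1
    \<comment> \<open>\<open>Swap 1\<close> crosses the end of the pair that \<open>cost\<close> may
      consume, so the induction hypothesis for that branch does not cover it. A third letter is
      exposed and the cases are checked.\<close>
    then obtain c u' d v' where uv: "u = c # u'" "v = d # v'" "a' \<noteq> c"
      using 1 by (cases u; cases v) auto
    have l2: "length u' = length v'" using len uv by simp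
    have *: "applicable (Swap 0) (a' # u)" using uv by simp
    note bnds2 = cost_Cons_ge[OF l2, of True d] cost_Cons_le[OF l2, of True d]
      cost_Cons_ge[OF l2, of False d] cost_Cons_le[OF l2, of False d]
    show ?thesis
    proof (cases "a = b")
      case True
      then show ?thesis using S1 uv "1.IH"(1)[OF True _ *] len by simp
    next
      case False
      then have "b = (\<not> a)" "c = (\<not> a')" using uv by auto
      then show ?thesis unfolding uv S1 using bnds2 l2
        by (cases a; cases b'; cases a'; cases d) simp_all
    qed
  next
    case (S i)
    have *: "applicable (Swap (Suc i)) (a' # u)" "applicable (Swap i) u" using 1 S by auto
    consider "a = b" | "a \<noteq> b" "a' \<noteq> b' \<and> a \<noteq> a'" | "a \<noteq> b" "\<not> (a' \<noteq> b' \<and> a \<noteq> a')" by blast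
    then show ?thesis
    proof cases
      case 1
      then show ?thesis using "1.IH"(1)[OF 1 _ *(1)] S len by simp
    next
      case 2
      then show ?thesis using "1.IH"(2)[OF 2 _ *(2)] S len by simp
    next
      case 3
      then show ?thesis using "1.IH"(3)[OF 3 _ *(1)] S len by auto
    qed
  qed
qed simp_all

lemma length_apply_edit [simp]: "length (apply_edit e u) = length u"
  by (cases e) auto

lemma cost_relpow:
  assumes "(edit_step ^^ n) u v"
  shows "length u = length v \<and> cost u v \<le> n"
  using assms
proof (induction n arbitrary: u)
  case (Suc n)
  then obtain w where "edit_step u w" "(edit_step ^^ n) w v"
    by (meson relpowp_Suc_D2)
  then show ?case using Suc.IH[of w] cost_apply_edit unfolding edit_step_def
    by (metis Suc_le_mono le_trans length_apply_edit)
qed auto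

text \<open>No path is shorter than the cost, so a path of that length determines the
  distance.\<close>

lemma tilde_dist_eqI:
  assumes "(edit_step ^^ n) u v" "n \<le> cost u v"
  shows "tilde_dist u v = n"
  unfolding tilde_dist_def
  by (rule Least_equality) (use assms cost_relpow in \<open>blast intro: order.trans\<close>)+

lemma apply_edit_neq: "applicable e u \<Longrightarrow> apply_edit e u \<noteq> u"
  by (cases e) (auto simp: list_eq_iff_nth_eq nth_list_update)

lemma tilde_dist_apply_edit:
  assumes "applicable e u"
  shows "tilde_dist u (apply_edit e u) = 1"
proof -
  have "(edit_step ^^ 1) u (apply_edit e u)"
    unfolding relpowp_1 edit_step_def using assms by blast
  moreover have "\<not> (edit_step ^^ 0) u (apply_edit e u)" using apply_edit_neq[OF assms] by auto
  ultimately show ?thesis unfolding tilde_dist_def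
    by (intro Least_equality) (metis less_one not_le_imp_less)+
qed

section \<open>Edits that make progress at the first mismatch\<close>

lemma cost_first_mismatch:
  assumes "length u = length v" "\<forall>i<p. u ! i = v ! i" "p \<le> length u"
  shows "cost u v = cost (drop p u) (drop p v)"
  using assms
proof (induction p arbitrary: u v)
  case (Suc p)
  then obtain a u' b v' where uv: "u = a # u'" "v = b # v'" by (cases u; cases v) auto
  have "a = b" using Suc.prems(2) uv by auto
  moreover have "\<forall>i<p. u' ! i = v' ! i" using Suc.prems(2) uv by auto
  ultimately show ?case using Suc.IH[of u' v'] Suc.prems uv by auto
qed auto

definition mismatch :: "word \<Rightarrow> word \<Rightarrow> nat set" where
  "mismatch u v = {i. i < length u \<and> u ! i \<noteq> v ! i}"

text \<open>Since the alphabet is binary, an edit confined to mismatches corrects every position it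
  touches. Such a position never becomes a mismatch again, whence each position is modified at most
  once.\<close>

definition progress :: "edit \<Rightarrow> word \<Rightarrow> word \<Rightarrow> bool" where
  "progress e u v \<longleftrightarrow> applicable e u \<and> modified e \<subseteq> mismatch u v \<and>
     Suc (cost (apply_edit e u) v) = cost u v"

context
  fixes u v :: word and p :: nat
  assumes len: "length u = length v" and p: "p < length u"
    and agree: "\<forall>i<p. u ! i = v ! i" and mis: "u ! p \<noteq> v ! p"
begin

lemma cost_u: "cost u v = cost (drop p u) (drop p v)"
  using cost_first_mismatch len agree p by simp

lemma cost_upd:
  assumes "length u' = length u" "\<forall>i<p. u' ! i = u ! i"
  shows "cost u' v = cost (drop p u') (drop p v)"
  using cost_first_mismatch[of u' v p] len agree p assms by simp

lemma progress_Repl_single: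
  assumes "\<not> (Suc p < length u \<and> u ! Suc p \<noteq> v ! Suc p \<and> u ! Suc p \<noteq> u ! p)"
  shows "progress (Repl p) u v"
proof -
  let ?u = "u[p := \<not> u ! p]"
  have 1: "cost ?u v = cost (drop p ?u) (drop p v)"
    by (rule cost_upd) auto
  have "Suc (cost ?u v) = cost u v"
  proof (cases "Suc p < length u")
    case True
    then show ?thesis unfolding 1 cost_u using p len mis assms
      by (auto simp: Cons_nth_drop_Suc[symmetric])
  next
    case False
    then show ?thesis unfolding 1 cost_u using p len mis assms
      by (auto simp: Cons_nth_drop_Suc[symmetric])
  qed
  then show ?thesis using p mis by (auto simp: progress_def mismatch_def)
qed

lemma progress_Swap:
  assumes "Suc p < length u" "u ! Suc p \<noteq> v ! Suc p" "u ! Suc p \<noteq> u ! p"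
  shows "progress (Swap p) u v"
proof -
  let ?u = "u[p := u ! Suc p, Suc p := u ! p]"
  have 1: "cost ?u v = cost (drop p ?u) (drop p v)"
    by (rule cost_upd) auto
  have "drop p ?u = v ! p # v ! Suc p # drop (Suc (Suc p)) u"
    using assms p mis by (auto simp: Cons_nth_drop_Suc[symmetric])
  moreover have "drop p v = v ! p # v ! Suc p # drop (Suc (Suc p)) v"
    using assms(1) p len by (simp add: Cons_nth_drop_Suc)
  moreover have "drop p u = u ! p # u ! Suc p # drop (Suc (Suc p)) u"
    using assms(1) p len by (simp add: Cons_nth_drop_Suc)
  ultimately have "Suc (cost ?u v) = cost u v"
    unfolding 1 cost_u using mis assms len by simp
  then show ?thesis using p mis assms by (auto simp: progress_def mismatch_def)
qed

text \<open>The last hypothesis ends the alternating run of mismatches after three letters. Such a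
  run costs 2 both ways: swap then replacement, as the greedy reading has it, or replacement then
  swap.\<close>

lemma progress_run3:
  assumes "Suc (Suc (Suc p)) < length u" "u ! Suc p \<noteq> v ! Suc p" "u ! Suc p \<noteq> u ! p"
     "u ! Suc (Suc p) \<noteq> v ! Suc (Suc p)" "u ! Suc (Suc p) = u ! p"
     "\<not> (u ! Suc (Suc (Suc p)) \<noteq> v ! Suc (Suc (Suc p)) \<and> u ! Suc (Suc (Suc p)) \<noteq> u ! p)"
  shows "progress (Repl p) u v" "progress (Swap (Suc p)) u v"
proof -
  let ?x = "drop (Suc (Suc (Suc p))) u" and ?y = "drop (Suc (Suc (Suc p))) v"
  have dv: "drop p v = v ! p # v ! Suc p # v ! Suc (Suc p) # ?y"
    using assms(1) p len by (simp add: Cons_nth_drop_Suc)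
  have du: "drop p u = u ! p # u ! Suc p # u ! Suc (Suc p) # ?x"
    using assms(1) p len by (simp add: Cons_nth_drop_Suc)
  have xy: "?x = u ! Suc (Suc (Suc p)) # drop (Suc (Suc (Suc (Suc p)))) u"
     "?y = v ! Suc (Suc (Suc p)) # drop (Suc (Suc (Suc (Suc p)))) v"
    using assms(1) p len by (simp_all add: Cons_nth_drop_Suc)
  have cu: "cost u v = Suc (Suc (cost ?x ?y))"
    unfolding cost_u du dv using assms mis xy by auto
  let ?u = "u[p := \<not> u ! p]"
  have 1: "cost ?u v = cost (drop p ?u) (drop p v)"
    by (rule cost_upd) auto
  have "drop p ?u = v ! p # u ! Suc p # u ! Suc (Suc p) # ?x"
    using assms p mis by (auto simp: Cons_nth_drop_Suc[symmetric])
  then have "Suc (cost ?u v) = cost u v"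
    unfolding 1 cu dv using assms by (auto simp: xy)
  then show "progress (Repl p) u v" using p mis assms by (auto simp: progress_def mismatch_def)
  let ?u = "u[Suc p := u ! Suc (Suc p), Suc (Suc p) := u ! Suc p]"
  have 1: "cost ?u v = cost (drop p ?u) (drop p v)"
    by (rule cost_upd) auto
  have "drop p ?u = u ! p # v ! Suc p # v ! Suc (Suc p) # ?x"
    using assms p mis by (auto simp: Cons_nth_drop_Suc[symmetric])
  then have "Suc (cost ?u v) = cost u v"
    unfolding 1 cu dv using assms mis by (auto simp: xy)
  then show "progress (Swap (Suc p)) u v" using p mis assms by (auto simp: progress_def mismatch_def)
qed

end

section \<open>Occurrences created by a single edit\<close>

text \<open>An occurrence of \<open>1\<^sup>h0\<^sup>k\<close> in \<open>w\<close> is located by the position \<open>b\<close> of its first zero.\<close>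

definition occ :: "nat \<Rightarrow> nat \<Rightarrow> word \<Rightarrow> nat \<Rightarrow> bool" where
  "occ h k w b \<longleftrightarrow> h \<le> b \<and> b + k \<le> length w \<and>
     (\<forall>i. b \<le> i + h \<and> i < b \<longrightarrow> w ! i) \<and> (\<forall>i. b \<le> i \<and> i < b + k \<longrightarrow> \<not> w ! i)"

lemma free_of_iff_no_occ: "free_of (ones_zeros h k) w \<longleftrightarrow> (\<forall>b. \<not> occ h k w b)"
proof -
  have "sublist (ones_zeros h k) w \<longleftrightarrow> (\<exists>b. occ h k w b)"
  proof
    assume "sublist (ones_zeros h k) w"
    then obtain ps ss where "w = ps @ ones_zeros h k @ ss" by (auto simp: sublist_def)
    then have "occ h k w (length ps + h)"
      by (auto simp: occ_def ones_zeros_def nth_append)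
    then show "\<exists>b. occ h k w b" ..
  next
    assume "\<exists>b. occ h k w b"
    then obtain b where b: "occ h k w b" ..
    have "take h (drop (b - h) w) = replicate h True"
      by (rule nth_equalityI) (use b in \<open>auto simp: occ_def\<close>)
    moreover have "take k (drop h (drop (b - h) w)) = replicate k False"
      by (rule nth_equalityI) (use b in \<open>auto simp: occ_def\<close>)
    ultimately have "take (h + k) (drop (b - h) w) = ones_zeros h k"
      by (simp add: take_add ones_zeros_def)
    then have "w = take (b - h) w @ ones_zeros h k @ drop (h + k) (drop (b - h) w)"
      by (metis append_take_drop_id)
    then show "sublist (ones_zeros h k) w" unfolding sublist_def by blast
  qed
  then show ?thesis by (simp add: free_of_def)
qed

lemma occI:
  assumes "h \<le> b" "b + k \<le> length w" "\<And>i. b \<le> i + h \<Longrightarrow> i < b \<Longrightarrow> w ! i"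
    "\<And>i. b \<le> i \<Longrightarrow> i < b + k \<Longrightarrow> \<not> w ! i"
  shows "occ h k w b"
  using assms by (auto simp: occ_def)

lemma occD:
  assumes "occ h k w b"
  shows "h \<le> b" "b + k \<le> length w" "\<And>i. b \<le> i + h \<Longrightarrow> i < b \<Longrightarrow> w ! i"
    "\<And>i. b \<le> i \<Longrightarrow> i < b + k \<Longrightarrow> \<not> w ! i"
  using assms by (auto simp: occ_def)

text \<open>A new occurrence must cover the flipped position, and the new letter there tells in
  which of the two blocks it lies. All other letters of the window are those of
  \<open>w\<close>.\<close>

lemma occ_Repl:
  assumes "occ h k (apply_edit (Repl p) w) b" "\<not> occ h k w b" "p < length w"
  shows "w ! p \<Longrightarrow> b \<le> p \<and> p < b + k"
    and "\<not> w ! p \<Longrightarrow> p < b \<and> b \<le> p + h"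
    and "h \<le> b" "b + k \<le> length w"
    and "\<And>i. b \<le> i + h \<Longrightarrow> i < b \<Longrightarrow> i \<noteq> p \<Longrightarrow> w ! i"
    and "\<And>i. b \<le> i \<Longrightarrow> i < b + k \<Longrightarrow> i \<noteq> p \<Longrightarrow> \<not> w ! i"
proof -
  let ?w = "w[p := \<not> w ! p]"
  have o: "occ h k ?w b" using assms by simp
  show 1: "h \<le> b" "b + k \<le> length w" using occD[OF o] by auto
  show 2: "w ! i" if "b \<le> i + h" "i < b" "i \<noteq> p" for i
    using occD(3)[OF o that(1,2)] that by simp
  show 3: "\<not> w ! i" if "b \<le> i" "i < b + k" "i \<noteq> p" for i
    using occD(4)[OF o that(1,2)] that by simp
  have 4: "b \<le> p + h \<and> p < b + k"
  proof (rule ccontr)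
    assume "\<not> ?thesis"
    then have "occ h k w b" using 1 2 3 by (intro occI) auto
    then show False using assms by blast
  qed
  show "b \<le> p \<and> p < b + k" if "w ! p"
    using 4 occD(3)[OF o, of p] that assms by (auto simp: not_less[symmetric])
  show "p < b \<and> b \<le> p + h" if "\<not> w ! p"
    using 4 occD(4)[OF o, of p] that assms by (auto simp: not_less[symmetric])
qed

text \<open>The swapped letters read 10. The 1 cannot lie among the zeros nor the 0 among the ones,
  so the boundary of the window falls exactly between them.\<close>

lemma occ_Swap_01:
  assumes "occ h k (apply_edit (Swap p) w) b" "\<not> occ h k w b"
    and "Suc p < length w" "\<not> w ! p" "w ! Suc p"
  shows "b = Suc p" "h \<le> Suc p" "Suc p + k \<le> length w"
    and "\<And>i. Suc p \<le> i + h \<Longrightarrow> i < p \<Longrightarrow> w ! i"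
    and "\<And>i. Suc p < i \<Longrightarrow> i < Suc p + k \<Longrightarrow> \<not> w ! i"
proof -
  let ?w = "w[p := True, Suc p := False]"
  have o: "occ h k ?w b" using assms by simp
  have 1: "h \<le> b" "b + k \<le> length w" using occD[OF o] by auto
  have 2: "w ! i" if "b \<le> i + h" "i < b" "i \<noteq> p" "i \<noteq> Suc p" for i
    using occD(3)[OF o that(1,2)] that by simp
  have 3: "\<not> w ! i" if "b \<le> i" "i < b + k" "i \<noteq> p" "i \<noteq> Suc p" for i
    using occD(4)[OF o that(1,2)] that by simp
  have 4: "b \<le> Suc p + h \<and> p < b + k"
  proof (rule ccontr)
    assume "\<not> ?thesis"
    then have "occ h k w b" using 1 2 3 by (intro occI) auto
    then show False using assms by blast
  qed
  have 5: "p < b" using 4 occD(4)[OF o, of p] assms by (auto simp: not_less[symmetric])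
  have 6: "b \<le> Suc p" using 4 occD(3)[OF o, of "Suc p"] assms by (auto simp: not_less[symmetric])
  show b: "b = Suc p" using 5 6 by simp
  show "h \<le> Suc p" "Suc p + k \<le> length w" using 1 b by auto
  show "w ! i" if "Suc p \<le> i + h" "i < p" for i using 2[of i] that b by auto
  show "\<not> w ! i" if "Suc p < i" "i < Suc p + k" for i using 3[of i] that b by auto
qed

text \<open>The swapped letters read 01, which is no factor of \<open>1\<^sup>h0\<^sup>k\<close>.
  Hence the window either ends with the 0 at \<open>p\<close> or begins with the 1 at
  \<open>Suc p\<close>.\<close>

lemma occ_Swap_10:
  assumes "occ h k (apply_edit (Swap p) w) b" "\<not> occ h k w b"
    and "Suc p < length w" "w ! p" "\<not> w ! Suc p"
  shows "b + k = Suc p \<and> 0 < k \<or> b = Suc p + h \<and> 0 < h" "h \<le> b" "b + k \<le> length w"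
    and "\<And>i. b \<le> i + h \<Longrightarrow> i < b \<Longrightarrow> i \<noteq> Suc p \<Longrightarrow> w ! i"
    and "\<And>i. b \<le> i \<Longrightarrow> i < b + k \<Longrightarrow> i \<noteq> p \<Longrightarrow> \<not> w ! i"
proof -
  let ?w = "w[p := False, Suc p := True]"
  have o: "occ h k ?w b" using assms by simp
  show 1: "h \<le> b" "b + k \<le> length w" using occD[OF o] by auto
  show 2: "w ! i" if "b \<le> i + h" "i < b" "i \<noteq> Suc p" for i
    using occD(3)[OF o that(1,2)] that assms(3-) by (cases "i = p") auto
  show 3: "\<not> w ! i" if "b \<le> i" "i < b + k" "i \<noteq> p" for i
    using occD(4)[OF o that(1,2)] that assms(3-) by (cases "i = Suc p") auto
  have 4: "b \<le> Suc p + h \<and> p < b + k \<and> 0 < h + k"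
  proof (rule ccontr)
    assume "\<not> ?thesis"
    then have "occ h k w b" using 1 2 3 by (intro occI) auto
    then show False using assms by blast
  qed
  have 5: "p < b \<Longrightarrow> p + h < b" using occD(3)[OF o, of p] assms by (auto simp: not_less[symmetric])
  have 6: "b \<le> Suc p \<Longrightarrow> b + k \<le> Suc p" using occD(4)[OF o, of "Suc p"] assms by (auto simp: not_less[symmetric])
  show "b + k = Suc p \<and> 0 < k \<or> b = Suc p + h \<and> 0 < h" using 4 5 6 by linarith
qed

section \<open>Existence of an edit that makes progress and keeps the word free\<close>

text \<open>Only edits at the first mismatch \<open>p\<close> or right after it are tried. If all of them create
  \<open>1\<^sup>h0\<^sup>k\<close>, both in \<open>u\<close> and in \<open>v\<close>, the letters forced by these occurrences and the common
  prefix produce an occurrence in \<open>u\<close> or \<open>v\<close> themselves, or \<open>h = k = 2\<close>.\<close>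

lemma free_progress_aux:
  assumes len: "length u = length v" and p: "p < length u"
    and agree: "\<forall>i<p. u ! i = v ! i" and up: "\<not> u ! p" and vp: "v ! p"
    and fu: "free_of (ones_zeros h k) u" and fv: "free_of (ones_zeros h k) v"
    and hk: "(h, k) \<noteq> (2, 2)"
  shows "\<exists>e. (progress e u v \<and> free_of (ones_zeros h k) (apply_edit e u)) \<or>
             (progress e v u \<and> free_of (ones_zeros h k) (apply_edit e v))"
proof (rule ccontr)
  assume "\<not> ?thesis"
  then have nu: "\<And>e. progress e u v \<Longrightarrow> \<exists>b. occ h k (apply_edit e u) b"
    and nv: "\<And>e. progress e v u \<Longrightarrow> \<exists>b. occ h k (apply_edit e v) b"
    by (auto simp: free_of_iff_no_occ)
  have ou: "\<not> occ h k u b" and ov: "\<not> occ h k v b" for b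
    using fu fv by (auto simp: free_of_iff_no_occ)
  have pv: "p < length v" using p len by simp
  have agree': "\<forall>i<p. v ! i = u ! i" using agree by simp
  have mis: "u ! p \<noteq> v ! p" "v ! p \<noteq> u ! p" using up vp by auto
  show False
  proof (cases "Suc p < length u \<and> u ! Suc p \<and> \<not> v ! Suc p")
    case False
    have "progress (Repl p) u v" using progress_Repl_single[OF len p agree mis(1)] False up by auto
    then obtain b where "occ h k (apply_edit (Repl p) u) b" using nu by blast
    note B = occ_Repl[OF this ou p]
    have "progress (Repl p) v u" using progress_Repl_single[OF len[symmetric] pv agree' mis(2)] False vp len by auto
    then obtain c where "occ h k (apply_edit (Repl p) v) c" using nv by blast
    note C = occ_Repl[OF this ov pv]
    have b: "p < b" "b \<le> p + h" and c: "c \<le> p" "p < c + k" using B(2) C(1) up vp by auto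
    \<comment> \<open>The part of the window at \<open>c\<close> before \<open>p\<close> lies in the
      common prefix, and at \<open>p\<close> the word \<open>u\<close> already has the 0 that the
      replacement puts into \<open>v\<close>. So \<open>u\<close> carries this window up to
      \<open>p\<close>.\<close>
    have uc: "u ! i" if "c \<le> i + h" "i < c" for i using C(5)[of i] that c agree by auto
    have uc0: "\<not> u ! i" if "c \<le> i" "i \<le> p" for i
      using C(6)[of i] that c agree up by (cases "i = p") auto
    show False
    proof (cases "Suc p = c + k")
      case True
      then have "occ h k u c" using C(3,4) uc uc0 len by (intro occI) auto
      then show False using ou by blast
    next
      case F: False
      \<comment> \<open>The window at \<open>c\<close> runs past \<open>p\<close>, so
        \<open>v\<close> has 0 at \<open>Suc p\<close>. Then so has \<open>u\<close>, and the ones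
        of the window at \<open>b\<close> end at \<open>p\<close>.\<close>
      then have vs: "\<not> v ! Suc p" "Suc p < length v" using C(4) C(6)[of "Suc p"] c by auto
      then have us: "\<not> u ! Suc p" using False len by auto
      then have b': "b = Suc p" using B(5)[of "Suc p"] b by linarith
      show False
      proof (cases "c = p")
        case True
        have "occ h k u p"
        proof (rule occI)
          show "\<not> u ! i" if "p \<le> i" "i < p + k" for i
            using B(6)[of i] that b' up by (cases "i = p") auto
        qed (use C(3) uc B(4) b' True in auto)
        then show False using ou by blast
      next
        case F2: False
        \<comment> \<open>Now \<open>p - 1\<close> is among the zeros at \<open>c\<close>, which
          leaves \<open>p\<close> as the only one before \<open>b\<close>. The zeros of
          \<open>u\<close> from \<open>c\<close> to \<open>p\<close> continue with those after
          \<open>b\<close>.\<close>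
        then have "c \<le> p - 1" "p - 1 < p" using c by auto
        then have "\<not> u ! (p - 1)" using uc0 by simp
        then have "h = 1" using B(5)[of "p - 1"] b b' \<open>p - 1 < p\<close> by linarith
        have "\<not> u ! i" if "c \<le> i" "i < c + k" for i
          using uc0[of i] B(6)[of i] that b' c by (cases "i \<le> p") auto
        then have "occ h k u c" using C(3,4) uc len by (intro occI) auto
        then show False using ou by blast
      qed
    qed
  next
    case True
    then have run: "Suc p < length u" "Suc p < length v" "u ! Suc p" "\<not> v ! Suc p" using len by auto
    have "progress (Swap p) u v" using progress_Swap[OF len p agree mis(1)] run up by auto
    then obtain b where "occ h k (apply_edit (Swap p) u) b" using nu by blast
    note B = occ_Swap_01[OF this ou run(1) up run(3)]
    have "progress (Swap p) v u" using progress_Swap[OF len[symmetric] pv agree' mis(2)] run vp by auto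
    then obtain c where oc: "occ h k (apply_edit (Swap p) v) c" using nv by blast
    note C = occ_Swap_10[OF oc ov run(2) vp run(4)]
    \<comment> \<open>A window ending at \<open>p\<close> would consist of common prefix and the 0
      at \<open>p\<close>, hence occur in \<open>u\<close> already.\<close>
    have "\<not> (c + k = Suc p \<and> 0 < k)"
    proof
      assume c: "c + k = Suc p \<and> 0 < k"
      have "occ h k u c"
      proof (rule occI)
        show "u ! i" if "c \<le> i + h" "i < c" for i
          using C(4)[of i] that c agree up by (cases "i < p") auto
        show "\<not> u ! i" if "c \<le> i" "i < c + k" for i
          using C(5)[of i] that c agree up by (cases "i = p") auto
      qed (use C(2,3) len in auto)
      then show False using ou by blast
    qed
    then have c: "c = Suc p + h" "h \<noteq> 0" using C(1) by auto
    \<comment> \<open>Otherwise the ones that \<open>B\<close> provides before \<open>p\<close>,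
      followed by the letters 10 of \<open>v\<close>, are already enough for an occurrence in
      \<open>v\<close>.\<close>
    have "2 \<le> k"
    proof (rule ccontr)
      assume "\<not> 2 \<le> k"
      have "occ h k v (Suc p)"
      proof (rule occI)
        show "v ! i" if "Suc p \<le> i + h" "i < Suc p" for i
          using B(4)[of i] that agree vp by (cases "i = p") auto
        show "\<not> v ! i" if "Suc p \<le> i" "i < Suc p + k" for i
        proof -
          have "i = Suc p" using that \<open>\<not> 2 \<le> k\<close> by linarith
          then show ?thesis using run by simp
        qed
      qed (use B(2,3) len in auto)
      then show False using ov by blast
    qed
    \<comment> \<open>For \<open>h = 1\<close> the letters 10 of \<open>v\<close> are followed by
      the zeros of the window at \<open>c\<close>, which starts its zeros at
      \<open>Suc (Suc p)\<close>.\<close>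
    have "2 \<le> h"
    proof (rule ccontr)
      assume "\<not> 2 \<le> h"
      then have h: "h = 1" using c by simp
      have "occ h k v (Suc p)"
      proof (rule occI)
        show "v ! i" if "Suc p \<le> i + h" "i < Suc p" for i
          using that h vp by (cases "i = p") auto
        show "\<not> v ! i" if "Suc p \<le> i" "i < Suc p + k" for i
          using C(5)[of i] c h run that by (cases "i = Suc p") auto
      qed (use B(2,3) len in auto)
      then show False using ov by blast
    qed
    \<comment> \<open>From \<open>p\<close> on, \<open>u\<close> reads \<open>010\<close> and \<open>v\<close> reads \<open>101\<close>. Only for \<open>h = k = 2\<close> can this alternating
      run of mismatches be longer, which would rule out replacing its first letter.\<close>
    have long: "Suc (Suc (Suc p)) < length u" "Suc (Suc (Suc p)) < length v"
      using C(3) c \<open>2 \<le> h\<close> \<open>2 \<le> k\<close> len by auto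
    have run2: "\<not> u ! Suc (Suc p)" "v ! Suc (Suc p)"
      using B(5)[of "Suc (Suc p)"] C(4)[of "Suc (Suc p)"] c \<open>2 \<le> h\<close> \<open>2 \<le> k\<close> by auto
    have u3: "3 \<le> k \<Longrightarrow> \<not> u ! Suc (Suc (Suc p))"
      using B(5)[of "Suc (Suc (Suc p))"] by auto
    have v3: "3 \<le> h \<Longrightarrow> v ! Suc (Suc (Suc p))"
      using C(4)[of "Suc (Suc (Suc p))"] c by auto
    have hk3: "3 \<le> h \<or> 3 \<le> k" using hk \<open>2 \<le> h\<close> \<open>2 \<le> k\<close> by auto
    then have stop: "\<not> (v ! Suc (Suc (Suc p)) \<noteq> u ! Suc (Suc (Suc p)) \<and> v ! Suc (Suc (Suc p)) \<noteq> v ! p)"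
      using u3 v3 vp by auto
    have prog: "progress (Repl p) v u" "progress (Swap (Suc p)) v u"
      using progress_run3[OF len[symmetric] pv agree' mis(2) long(2)] run run2 vp stop by auto
    show False
    proof (cases "3 \<le> k")
      case True
      obtain d where "occ h k (apply_edit (Repl p) v) d" using prog nv by blast
      note D = occ_Repl[OF this ov pv]
      have d: "d \<le> p" "p < d + k" using D(1) vp by auto
      \<comment> \<open>The 1 at \<open>Suc (Suc p)\<close> stops the zeros, so at least three of
        them around \<open>p\<close> reach back to \<open>p - 1\<close>. There \<open>B\<close>
        demands a 1, because \<open>2 \<le> h\<close>.\<close>
      have "\<not> Suc (Suc p) < d + k" using D(6)[of "Suc (Suc p)"] d run2 by auto
      then have "d \<le> p - 1" "p - 1 < p" using True d by auto
      then have "\<not> v ! (p - 1)" using D(6)[of "p - 1"] d by auto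
      moreover have "u ! (p - 1)" using B(4)[of "p - 1"] \<open>p - 1 < p\<close> \<open>2 \<le> h\<close> by auto
      ultimately show False using agree \<open>p - 1 < p\<close> by auto
    next
      case False
      then have "3 \<le> h" using hk3 by blast
      obtain d where "occ h k (apply_edit (Swap (Suc p)) v) d" using prog nv by blast
      note D = occ_Swap_01[OF this ov _ run(4) run2(2)]
      \<comment> \<open>With \<open>2 \<le> k\<close> the swap needs a 0 right after the exchanged
        pair, where \<open>v3\<close> gives a 1.\<close>
      show False using D(5)[of "Suc (Suc (Suc p))"] v3 \<open>3 \<le> h\<close> long \<open>2 \<le> k\<close> by auto
    qed
  qed
qed

lemma free_progress:
  assumes len: "length u = length v" and "u \<noteq> v"
    and fu: "free_of (ones_zeros h k) u" and fv: "free_of (ones_zeros h k) v"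
    and hk: "(h, k) \<noteq> (2, 2)"
  obtains e where "progress e u v" "free_of (ones_zeros h k) (apply_edit e u)"
    | e where "progress e v u" "free_of (ones_zeros h k) (apply_edit e v)"
proof -
  let ?P = "\<lambda>i. i < length u \<and> u ! i \<noteq> v ! i"
  define p where "p = (LEAST i. ?P i)"
  have "\<exists>i. ?P i" using len \<open>u \<noteq> v\<close> by (auto simp: list_eq_iff_nth_eq)
  then have p: "p < length u" "u ! p \<noteq> v ! p"
    unfolding p_def using LeastI_ex[of ?P] by blast+
  have agree: "\<forall>i<p. u ! i = v ! i"
    using not_less_Least[of _ ?P] p(1) unfolding p_def by (meson order.strict_trans)
  have pv: "p < length v" using len p by simp
  have agree': "\<forall>i<p. v ! i = u ! i" using agree by simp
  show thesis
  proof (cases "u ! p")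
    case True
    then show thesis
      using free_progress_aux[OF len[symmetric] pv agree' _ _ fv fu hk] p(2) that by blast
  next
    case False
    then show thesis
      using free_progress_aux[OF len p(1) agree _ _ fu fv hk] p(2) that by blast
  qed
qed

section \<open>Assembling the edits into a minimal transformation\<close>

text \<open>The last clause also forbids edits where \<open>u\<close> and \<open>v\<close> agree.
  This stronger invariant allows a further edit at either end, because the remaining script avoids
  the positions which that edit corrects.\<close>

definition free_script :: "word \<Rightarrow> word \<Rightarrow> edit list \<Rightarrow> word \<Rightarrow> bool" where
  "free_script f u es v \<longleftrightarrow> fold apply_edit es u = v \<and>
     (\<forall>j<length es. applicable (es ! j) (fold apply_edit (take j es) u)) \<and>
     (\<forall>j\<le>length es. free_of f (fold apply_edit (take j es) u)) \<and>
     (\<forall>i. length (filter (\<lambda>e. i \<in> modified e) es) \<le> (if i \<in> mismatch u v then 1 else 0))"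

lemma apply_edit_involution:
  assumes "applicable e u"
  shows "applicable e (apply_edit e u)" "apply_edit e (apply_edit e u) = u"
  using assms by (cases e; auto simp: list_eq_iff_nth_eq nth_list_update)+

lemma mismatch_apply_edit:
  assumes "applicable e u" "modified e \<subseteq> mismatch u v"
  shows "mismatch (apply_edit e u) v = mismatch u v - modified e"
  using assms by (cases e) (auto simp: mismatch_def nth_list_update split: if_splits)

lemma mismatch_commute: "length u = length v \<Longrightarrow> mismatch u v = mismatch v u"
  by (auto simp: mismatch_def)

lemma free_script_Cons:
  assumes "progress e u v" "free_of f u" "free_script f (apply_edit e u) es v"
  shows "free_script f u (e # es) v"
proof -
  have pr: "applicable e u" "modified e \<subseteq> mismatch u v"
    "mismatch (apply_edit e u) v = mismatch u v - modified e"
    using assms mismatch_apply_edit by (auto simp: progress_def)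
  have "length (filter (\<lambda>e. i \<in> modified e) (e # es)) \<le> (if i \<in> mismatch u v then 1 else 0)" for i
  proof -
    have "length (filter (\<lambda>e. i \<in> modified e) es) \<le> (if i \<in> mismatch u v - modified e then 1 else 0)"
      using assms(3) pr by (simp add: free_script_def)
    then show ?thesis using pr(2) by (auto split: if_splits)
  qed
  moreover have "applicable ((e # es) ! j) (fold apply_edit (take j (e # es)) u)"
    if "j < length (e # es)" for j
    using assms(3) pr that by (cases j) (auto simp: free_script_def)
  moreover have "free_of f (fold apply_edit (take j (e # es)) u)" if "j \<le> length (e # es)" for j
    using assms(2,3) that by (cases j) (auto simp: free_script_def)
  moreover have "fold apply_edit (e # es) u = v" using assms(3) by (simp add: free_script_def)
  ultimately show ?thesis unfolding free_script_def by blast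
qed

text \<open>The given script leads to \<open>apply_edit e v\<close>, and the same \<open>e\<close>
  leads from there back to \<open>v\<close>.\<close>

lemma free_script_snoc:
  assumes "length u = length v" "progress e v u" "free_of f v" "free_script f u es (apply_edit e v)"
  shows "free_script f u (es @ [e]) v"
proof -
  have pr: "applicable e v" "modified e \<subseteq> mismatch u v"
    "mismatch u (apply_edit e v) = mismatch u v - modified e"
    using assms mismatch_apply_edit[of e v u] mismatch_commute[of u]
    by (auto simp: progress_def)
  have fold: "fold apply_edit es u = apply_edit e v" using assms(4) by (simp add: free_script_def)
  have "length (filter (\<lambda>e. i \<in> modified e) (es @ [e])) \<le> (if i \<in> mismatch u v then 1 else 0)" for i
  proof -
    have "length (filter (\<lambda>e. i \<in> modified e) es) \<le> (if i \<in> mismatch u v - modified e then 1 else 0)"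
      using assms(4) pr by (simp add: free_script_def)
    then show ?thesis using pr(2) by (auto split: if_splits)
  qed
  moreover have "applicable ((es @ [e]) ! j) (fold apply_edit (take j (es @ [e])) u)"
    if "j < length (es @ [e])" for j
  proof (cases "j = length es")
    case True
    then show ?thesis using fold apply_edit_involution pr by simp
  next
    case False
    then show ?thesis using assms(4) that by (simp add: free_script_def nth_append)
  qed
  moreover have final: "fold apply_edit (es @ [e]) u = v"
    using fold apply_edit_involution pr by simp
  moreover have "free_of f (fold apply_edit (take j (es @ [e])) u)" if "j \<le> length (es @ [e])" for j
  proof (cases "j = length (es @ [e])")
    case True
    then have "take j (es @ [e]) = es @ [e]" by simp
    then show ?thesis using final assms(3) by simp
  next
    case False
    then show ?thesis using assms(4) that by (simp add: free_script_def)
  qed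
  ultimately show ?thesis unfolding free_script_def by blast
qed

lemma ex_free_script:
  assumes "length u = length v" "free_of (ones_zeros h k) u" "free_of (ones_zeros h k) v"
    and "(h, k) \<noteq> (2, 2)"
  shows "\<exists>es. length es = cost u v \<and> free_script (ones_zeros h k) u es v"
  using assms
proof (induction "cost u v" arbitrary: u v rule: less_induct)
  case less
  note len = less.prems(1) and fu = less.prems(2) and fv = less.prems(3) and hk = less.prems(4)
  show ?case
  proof (cases "u = v")
    case True
    then show ?thesis using fu by (intro exI[of _ "[]"]) (simp add: free_script_def)
  next
    case False
    from len False fu fv hk show ?thesis
    proof (cases rule: free_progress)
      case (1 e)
      have c: "Suc (cost (apply_edit e u) v) = cost u v" using 1 by (simp add: progress_def)
      then obtain es where "length es = cost (apply_edit e u) v"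
        "free_script (ones_zeros h k) (apply_edit e u) es v"
        using less.hyps[of "apply_edit e u" v] len 1(2) fv hk by auto
      then show ?thesis using free_script_Cons[OF 1(1) fu] c
        by (intro exI[of _ "e # es"]) simp
    next
      case (2 e)
      have c: "Suc (cost u (apply_edit e v)) = cost u v" using 2 by (simp add: progress_def cost_commute)
      then obtain es where "length es = cost u (apply_edit e v)"
        "free_script (ones_zeros h k) u es (apply_edit e v)"
        using less.hyps[of u "apply_edit e v"] len 2(2) fu hk by auto
      then show ?thesis using free_script_snoc[OF len 2(1) fv] c
        by (intro exI[of _ "es @ [e]"]) simp
    qed
  qed
qed

lemma relpow_fold_apply_edit:
  assumes "\<forall>j<length es. applicable (es ! j) (fold apply_edit (take j es) u)"
  shows "(edit_step ^^ length es) u (fold apply_edit es u)"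
  using assms
proof (induction es arbitrary: u)
  case (Cons e es)
  have "edit_step u (apply_edit e u)"
    using Cons.prems by (force simp: edit_step_def)
  moreover have "(edit_step ^^ length es) (apply_edit e u) (fold apply_edit es (apply_edit e u))"
    using Cons.prems by (intro Cons.IH) force
  ultimately show ?case by (simp add: relpowp_Suc_I2 del: relpowp.simps)
qed simp

lemma minimal_tilde_transformation_of_script:
  assumes "free_script f u es v" "length es = cost u v"
  defines "ws \<equiv> map (\<lambda>j. fold apply_edit (take j es) u) [0..<Suc (length es)]"
  shows "minimal_tilde_transformation ws u v" "\<forall>w\<in>set ws. free_of f w"
proof -
  have wsj: "ws ! j = fold apply_edit (take j es) u" if "j \<le> length es" for j
    unfolding ws_def using that by (subst nth_map) (auto simp del: upt_Suc)
  have lws: "length ws = Suc (length es)" by (simp add: ws_def)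
  have app: "applicable (es ! j) (ws ! j)" if "j < length es" for j
    using assms(1) that wsj by (simp add: free_script_def)
  have step: "ws ! Suc j = apply_edit (es ! j) (ws ! j)" if "j < length es" for j
    using that wsj by (simp add: take_Suc_conv_app_nth)
  have "(edit_step ^^ length es) u v"
    using relpow_fold_apply_edit[of es u] assms(1) by (auto simp: free_script_def)
  then have dist: "tilde_dist u v = length es" using assms(2) by (simp add: tilde_dist_eqI)
  have ne: "ws \<noteq> []" using lws by auto
  have "hd ws = u" using wsj[of 0] ne by (simp add: hd_conv_nth)
  moreover have "last ws = v" using wsj[of "length es"] ne lws assms(1)
    by (simp add: last_conv_nth free_script_def)
  ultimately have "tilde_transformation ws u v"
    using ne lws app step by (auto simp: tilde_transformation_def tilde_dist_apply_edit)
  moreover have "card {j. j < length es \<and> i \<in> modified (es ! j)} \<le> 1" for i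
  proof -
    have "length (filter (\<lambda>e. i \<in> modified e) es) \<le> 1"
      using assms(1) unfolding free_script_def by (metis le_zero_eq linear order.refl)
    then show ?thesis by (simp add: length_filter_conv_card)
  qed
  ultimately show "minimal_tilde_transformation ws u v"
    unfolding minimal_tilde_transformation_def using lws dist app step
    by (intro conjI exI[of _ es]) auto
  show "\<forall>w\<in>set ws. free_of f w"
    using assms(1) unfolding ws_def free_script_def by (auto simp del: upt_Suc simp: less_Suc_eq_le)
qed

lemma tilde_isometric_ones_zeros:
  assumes "h + k \<ge> 1" "(h, k) \<noteq> (2, 2)"
  shows "tilde_isometric (ones_zeros h k)"
  unfolding tilde_isometric_def
proof (intro conjI allI impI)
  show "1 \<le> length (ones_zeros h k)" using assms by (simp add: ones_zeros_def)
next
  fix u v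
  assume "length u = length v \<and> length (ones_zeros h k) \<le> length u \<and>
    free_of (ones_zeros h k) u \<and> free_of (ones_zeros h k) v"
  then show "\<exists>ws. minimal_tilde_transformation ws u v \<and> (\<forall>w\<in>set ws. free_of (ones_zeros h k) w)"
    using ex_free_script[of u v h k] assms(2) minimal_tilde_transformation_of_script by blast
qed

section \<open>The exceptional word 1100\<close>

lemma not_tilde_isometric_1100: "\<not> tilde_isometric (ones_zeros 2 2)"
proof
  let ?f = "ones_zeros 2 2"
  \<comment> \<open>The words differ in 0101 against 1010, an alternating run of four mismatches,
    framed by a common 1 and a common 0 so that correcting either half by a swap completes
    1100.\<close>
  let ?u = "[True, False, True, False, True, False]"
  let ?v = "[True, True, False, True, False, False]"
  \<comment> \<open>The distance is 2, and the only two candidates for the middle word, obtained from \<open>101010\<close>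
    by a swap, are \<open>110010\<close> and \<open>101100\<close>; both contain \<open>1100\<close>.\<close>
  have f: "?f = [True, True, False, False]" by (simp add: ones_zeros_def numeral_2_eq_2)
  assume "tilde_isometric ?f"
  moreover have "length ?u = length ?v" "length ?f \<le> length ?u" by (simp_all add: f)
  moreover have "free_of ?f ?u" "free_of ?f ?v"
    by (auto simp: f free_of_def sublist_Cons_right)
  ultimately obtain ws where ws: "minimal_tilde_transformation ws ?u ?v" "\<forall>w\<in>set ws. free_of ?f w"
    unfolding tilde_isometric_def by blast
  have "(edit_step ^^ length [Swap 1, Swap 3]) ?u (fold apply_edit [Swap 1, Swap 3] ?u)"
    by (rule relpow_fold_apply_edit) (auto simp: less_Suc_eq)
  then have "tilde_dist ?u ?v = 2"
    by (intro tilde_dist_eqI) (simp_all add: numeral_2_eq_2 del: relpowp.simps)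
  then have lws: "length ws = 3" using ws(1)
    by (auto simp: minimal_tilde_transformation_def tilde_transformation_def)
  from ws(1) obtain es where es: "length es = length ws - 1"
    "\<forall>k < length es. applicable (es ! k) (ws ! k) \<and> ws ! Suc k = apply_edit (es ! k) (ws ! k)"
    unfolding minimal_tilde_transformation_def by blast
  have "ws \<noteq> []" "hd ws = ?u" "last ws = ?v"
    using ws(1) by (auto simp: minimal_tilde_transformation_def tilde_transformation_def)
  then have ends: "ws ! 0 = ?u" "ws ! 2 = ?v"
    using lws by (auto simp: hd_conv_nth last_conv_nth)
  have app: "applicable (es ! 0) ?u" and w: "ws ! 1 = apply_edit (es ! 0) ?u"
    using es(1) es(2)[rule_format, of 0] lws ends by simp_all
  have "applicable (es ! 1) (ws ! 1)" "?v = apply_edit (es ! 1) (ws ! 1)"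
    using es(1) es(2)[rule_format, of 1] lws ends by (simp_all add: numeral_2_eq_2)
  \<comment> \<open>This bound excludes every first edit of \<open>?u\<close> except the two
    swaps.\<close>
  then have "cost (ws ! 1) ?v \<le> 1"
    using cost_apply_edit[of "ws ! 1" ?v "es ! 1"] w by simp
  moreover have "free_of [True, True, False, False] (ws ! 1)" using ws(2) lws f by simp
  ultimately show False unfolding w using app
    by (cases "es ! 0") (auto simp: free_of_def less_Suc_eq numeral_2_eq_2 sublist_Cons_right)
qed

theorem proposition12:
  shows "(\<forall>h k :: nat. h + k \<ge> 1 \<and> (h, k) \<noteq> (2, 2) \<longrightarrow> tilde_isometric (ones_zeros h k))
       \<and> tilde_non_isometric (ones_zeros 2 2)"
  using tilde_isometric_ones_zeros not_tilde_isometric_1100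
  by (simp add: tilde_non_isometric_def ones_zeros_def)

end
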